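(* For each $n\in\mathbb{N}$, the $n$-dimensional unit sphere $\mathbf{S}^n$ is $CT_4$.
   Context: $\mathbb{N}=\{1,2,\dots\}$ and $\mathbf{S}^n=\{x\in\mathbb{R}^{n+1}:\|x\|=1\}$ with the Euclidean topology. For a space $X$, $\mathrm{Cld}(X)$ denotes the set of all non-empty closed subsets of $X$, endowed with the Vietoris topology, i.e. the topology having as a subbase all sets $U^-=\{F\in\mathrm{Cld}(X): F\cap U\neq\emptyset\}$ and $U^+=\{F\in\mathrm{Cld}(X): F\subseteq U\}$ with $U$ open in $X$. Let $\mathcal{T}_4(X)=\{(F_1,F_2)\in\mathrm{Cld}(X)^2: F_1\cap F_2=\emptyset\}$, with the subspace topology from the product space $\mathrm{Cld}(X)^2$. The space $X$ is called $CT_4$ if there is a continuous map $\phi=(\phi_1,\phi_2):\mathcal{T}_4(X)\to\mathrm{Cld}(X)^2$ such that for every $(F_1,F_2)\in\mathcal{T}_4(X)$: $\phi_1(F_1,F_2)\cup\phi_2(F_1,F_2)=X$ and $F_j\cap\phi_j(F_1,F_2)=\emptyset$ for $j=1,2$. *)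

theory Defs
  imports "HOL-Analysis.Analysis"
begin

definition Cld :: "'a topology \<Rightarrow> 'a set set" where
  "Cld X = {F. closedin X F \<and> F \<noteq> {}}"

definition vietoris_minus :: "'a topology \<Rightarrow> 'a set \<Rightarrow> 'a set set" where
  "vietoris_minus X U = {F \<in> Cld X. F \<inter> U \<noteq> {}}"

definition vietoris_plus :: "'a topology \<Rightarrow> 'a set \<Rightarrow> 'a set set" where
  "vietoris_plus X U = {F \<in> Cld X. F \<subseteq> U}"

definition vietoris :: "'a topology \<Rightarrow> 'a set topology" where
  "vietoris X =
     topology_generated_by ({vietoris_minus X U | U. openin X U} \<union> {vietoris_plus X U | U. openin X U})"

text \<open>\<^const>\<open>topology_generated_by\<close> takes the union of the subbase as its carrier; here
  this is all of \<^term>\<open>Cld X\<close>, already because of \<^term>\<open>vietoris_plus X (topspace X)\<close>.\<close>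

lemma topspace_vietoris [simp]: "topspace (vietoris X) = Cld X"
proof -
  let ?S = "{vietoris_minus X U | U. openin X U} \<union> {vietoris_plus X U | U. openin X U}"
  have "vietoris_plus X (topspace X) = Cld X"
    by (auto simp: vietoris_plus_def Cld_def dest: closedin_subset)
  then have "Cld X \<in> ?S"
    using openin_topspace by blast
  moreover have "\<Union>?S \<subseteq> Cld X"
    by (auto simp: vietoris_minus_def vietoris_plus_def)
  ultimately have "\<Union>?S = Cld X"
    by blast
  then show ?thesis
    unfolding vietoris_def topology_generated_by_topspace .
qed

definition T4_pairs :: "'a topology \<Rightarrow> ('a set \<times> 'a set) set" where
  "T4_pairs X = {(F1, F2). F1 \<in> Cld X \<and> F2 \<in> Cld X \<and> F1 \<inter> F2 = {}}"

definition T4_space :: "'a topology \<Rightarrow> ('a set \<times> 'a set) topology" where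
  "T4_space X = subtopology (prod_topology (vietoris X) (vietoris X)) (T4_pairs X)"

definition CT4 :: "'a topology \<Rightarrow> bool" where
  "CT4 X \<longleftrightarrow>
     (\<exists>\<phi>. continuous_map (T4_space X) (prod_topology (vietoris X) (vietoris X)) \<phi> \<and>
          (\<forall>F1 F2. (F1, F2) \<in> T4_pairs X \<longrightarrow>
             fst (\<phi> (F1, F2)) \<union> snd (\<phi> (F1, F2)) = topspace X \<and>
             F1 \<inter> fst (\<phi> (F1, F2)) = {} \<and>
             F2 \<inter> snd (\<phi> (F1, F2)) = {}))"

end

theory Submission
  imports Defs
begin

text \<open>
  Given disjoint nonempty closed sets \<open>F\<^sub>1\<close>, \<open>F\<^sub>2\<close> of the sphere, let \<open>\<phi>\<^sub>1 (F\<^sub>1, F\<^sub>2)\<close> be the set of points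
  at least as close to \<open>F\<^sub>2\<close> as to \<open>F\<^sub>1\<close>, and let \<open>\<phi>\<^sub>2 (F\<^sub>1, F\<^sub>2) = \<phi>\<^sub>1 (F\<^sub>2, F\<^sub>1)\<close>. These two sets cover
  the sphere, and \<open>F\<^sub>1\<close> misses the first and \<open>F\<^sub>2\<close> the second. On the sphere, closeness of \<open>x\<close> and \<open>y\<close>
  is measured by the inner product \<open>x \<bullet> y\<close>: the larger it is, the closer the points are.

  Continuity splits into two halves. That \<open>x\<close> is strictly closer to \<open>F\<^sub>1\<close> is an open condition on
  \<open>(x, (F\<^sub>1, F\<^sub>2))\<close> (\<open>closedin_closer_to_snd_graph\<close>). By compactness, the pairs whose image under
  \<open>\<phi>\<^sub>1\<close> meets the complement of an open set \<open>U\<close> therefore form a closed set; this deals with the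
  subbasic sets \<open>U\<^sup>+\<close>, and it works in every compact space with a continuous closeness function. For \<open>U\<^sup>-\<close> one must know that the points strictly closer to \<open>F\<^sub>2\<close> are
  dense in \<open>\<phi>\<^sub>1 (F\<^sub>1, F\<^sub>2)\<close>, since being strictly closer to \<open>F\<^sub>2\<close> is stable under small changes of the two
  sets. This is where the geometry of the sphere enters: if \<open>p \<in> F\<^sub>2\<close> is a point of \<open>F\<^sub>2\<close> closest to
  \<open>x\<close> and \<open>y\<close> is the normalization of \<open>x + t p\<close> for small \<open>t > 0\<close>, then for \<open>q \<in> F\<^sub>1\<close> both \<open>x \<bullet> q \<le> x \<bullet> p\<close> and
  \<open>p \<bullet> q < 1 = p \<bullet> p\<close>, so that \<open>y \<bullet> q < y \<bullet> p\<close> (\<open>dot_approach\<close>).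
\<close>

section \<open>Closeness functions on a compact space\<close>

text \<open>
  A closeness function \<open>s\<close> on a compact space, larger values meaning closer points. The last axiom
  states that every \<open>x\<close> can be moved, by an arbitrarily small amount, so as to favour a given point
  \<open>p\<close> strictly over all other points \<open>q\<close> that were not already closer to \<open>x\<close> than \<open>p\<close>.
\<close>

locale closeness =
  fixes X :: "'a topology" and s :: "'a \<Rightarrow> 'a \<Rightarrow> real"
  assumes compact: "compact_space X"
    and cont: "continuous_map (prod_topology X X) euclideanreal (\<lambda>z. s (fst z) (snd z))"
    and self: "\<lbrakk>x \<in> topspace X; y \<in> topspace X; y \<noteq> x\<rbrakk> \<Longrightarrow> s x y < s x x"
    and approach: "\<lbrakk>openin X U; x \<in> U; p \<in> topspace X\<rbrakk> \<Longrightarrow>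
      \<exists>y\<in>U. \<forall>q\<in>topspace X. q \<noteq> p \<longrightarrow> s x q \<le> s x p \<longrightarrow> s y q < s y p"
begin

text \<open>
  The points at least as close to the second set of a pair as to the first. Since suprema over
  compact sets are attained, quantifiers express the comparison of the suprema of \<open>s x\<close>
  over the two sets.
\<close>

definition closer_to_snd :: "'a set \<times> 'a set \<Rightarrow> 'a set" where
  "closer_to_snd P = {x \<in> topspace X. \<forall>q\<in>fst P. \<exists>p\<in>snd P. s x q \<le> s x p}"

lemma continuous_map_closeness: "x \<in> topspace X \<Longrightarrow> continuous_map X euclideanreal (s x)"
  using continuous_map_compose[OF _ cont, of X "\<lambda>y. (x, y)"]
  by (simp add: continuous_map_pairedI o_def)

lemma Cld_attains_closest:
  assumes "F \<in> Cld X" "x \<in> topspace X"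
  obtains p where "p \<in> F" "\<And>q. q \<in> F \<Longrightarrow> s x q \<le> s x p"
proof -
  have "compactin X F" "F \<noteq> {}"
    using assms closedin_compact_space[OF compact] by (auto simp: Cld_def)
  then have "compact (s x ` F)" "s x ` F \<noteq> {}"
    using image_compactin[OF _ continuous_map_closeness[OF assms(2)]] by auto
  from compact_attains_sup[OF this] show ?thesis
    using that by auto
qed

lemma topspace_T4_space: "topspace (T4_space X) = T4_pairs X"
  by (auto simp: T4_space_def T4_pairs_def)

lemma Cld_subset_topspace: "F \<in> Cld X \<Longrightarrow> F \<subseteq> topspace X"
  by (auto simp: Cld_def closedin_subset)

lemma openin_vietoris_minus: "openin X U \<Longrightarrow> openin (vietoris X) (vietoris_minus X U)"
  unfolding vietoris_def by (rule topology_generated_by_Basis) auto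

lemma openin_vietoris_plus: "openin X U \<Longrightarrow> openin (vietoris X) (vietoris_plus X U)"
  unfolding vietoris_def by (rule topology_generated_by_Basis) auto

lemma openin_T4_space_Times:
  assumes "openin (vietoris X) A" "openin (vietoris X) B"
  shows "openin (T4_space X) (T4_pairs X \<inter> A \<times> B)"
  unfolding T4_space_def using assms
  by (simp add: openin_prod_Times_iff openin_subtopology_Int2)

text \<open>
  The relation "\<open>x\<close> is at least as close to \<open>F\<^sub>2\<close> as to \<open>F\<^sub>1\<close>" is closed: if some \<open>q \<in> F\<^sub>1\<close> beats all
  of \<open>F\<^sub>2\<close>, a real number \<open>c\<close> separates \<open>s x q\<close> from \<open>s x p\<close> for all \<open>p \<in> F\<^sub>2\<close>, and it keeps
  separating when \<open>x\<close>, \<open>F\<^sub>1\<close> and \<open>F\<^sub>2\<close> vary slightly.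
\<close>

lemma closedin_closer_to_snd_graph:
  "closedin (prod_topology X (T4_space X)) {(x, P). P \<in> T4_pairs X \<and> x \<in> closer_to_snd P}"
proof -
  let ?Z = "prod_topology X (T4_space X)"
  let ?G = "{(x, P). P \<in> T4_pairs X \<and> x \<in> closer_to_snd P}"
  have "\<exists>N. openin ?Z N \<and> z \<in> N \<and> N \<subseteq> topspace ?Z - ?G" if z: "z \<in> topspace ?Z - ?G" for z
  proof -
    obtain x F1 F2 where zeq: "z = (x, F1, F2)"
      using prod_cases3 by blast
    have x: "x \<in> topspace X" and P: "(F1, F2) \<in> T4_pairs X" and nx: "x \<notin> closer_to_snd (F1, F2)"
      using z by (auto simp: zeq topspace_T4_space)
    have F: "F1 \<in> Cld X" "F2 \<in> Cld X"
      using P by (auto simp: T4_pairs_def)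
    obtain q where q: "q \<in> F1" "\<And>p. p \<in> F2 \<Longrightarrow> s x p < s x q"
      using nx x by (force simp: closer_to_snd_def)
    obtain m where m: "m \<in> F2" "\<And>p. p \<in> F2 \<Longrightarrow> s x p \<le> s x m"
      using Cld_attains_closest[OF F(2) x] by blast
    obtain c where c: "s x m < c" "c < s x q"
      using q(2)[OF m(1)] dense by blast
    define L where "L = {z \<in> topspace (prod_topology X X). s (fst z) (snd z) \<in> {..<c}}"
    define R where "R = {z \<in> topspace (prod_topology X X). s (fst z) (snd z) \<in> {c<..}}"
    have LR: "openin (prod_topology X X) L" "openin (prod_topology X X) R"
      unfolding L_def R_def by (rule openin_continuous_map_preimage[OF cont]; simp)+
    have "{x} \<times> F2 \<subseteq> L"
      using x m c Cld_subset_topspace[OF F(2)] by (fastforce simp: L_def)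
    moreover have "compactin X F2"
      using F(2) closedin_compact_space[OF compact] by (auto simp: Cld_def)
    ultimately obtain W1 V1 where
      W1: "openin X W1" "x \<in> W1" and V1: "openin X V1" "F2 \<subseteq> V1" and sub1: "W1 \<times> V1 \<subseteq> L"
      using tube_lemma_right[OF LR(1) _ x, of F2] by blast
    have "(x, q) \<in> R"
      using x q c Cld_subset_topspace[OF F(1)] by (auto simp: R_def)
    then obtain W2 V2 where
      W2: "openin X W2" "x \<in> W2" and V2: "openin X V2" "q \<in> V2" and sub2: "W2 \<times> V2 \<subseteq> R"
      using LR(2) unfolding openin_prod_topology_alt by blast
    let ?N = "(W1 \<inter> W2) \<times> (T4_pairs X \<inter> vietoris_minus X V2 \<times> vietoris_plus X V1)"
    have N: "openin ?Z ?N"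
      using W1 W2 V1 V2
      by (simp add: openin_prod_Times_iff openin_Int openin_T4_space_Times
          openin_vietoris_minus openin_vietoris_plus)
    have zN: "z \<in> ?N"
      using W1 W2 V1 V2 P F q(1) by (auto simp: zeq vietoris_minus_def vietoris_plus_def)
    have "?N \<subseteq> - ?G"
    proof clarify
      fix y E1 E2
      assume y: "y \<in> W1" "y \<in> W2" and E: "E1 \<in> vietoris_minus X V2" "E2 \<in> vietoris_plus X V1"
        and cl: "y \<in> closer_to_snd (E1, E2)"
      obtain q' where q': "q' \<in> E1" "q' \<in> V2"
        using E by (auto simp: vietoris_minus_def)
      then obtain p' where p': "p' \<in> E2" "s y q' \<le> s y p'"
        using cl by (auto simp: closer_to_snd_def)
      have "p' \<in> V1"
        using p' E by (auto simp: vietoris_plus_def)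
      then have "s y p' < c" "c < s y q'"
        using sub1 sub2 y q' by (auto simp: L_def R_def)
      with p' show False
        by simp
    qed
    then have "?N \<subseteq> topspace ?Z - ?G"
      using openin_subset[OF N] by (simp only: Diff_eq Int_subset_iff)
    with N zN show ?thesis
      by (intro exI conjI)
  qed
  then have "openin ?Z (topspace ?Z - ?G)"
    by (intro iffD2[OF openin_subopen] ballI)
  moreover have "?G \<subseteq> topspace ?Z"
    by (auto simp: topspace_T4_space closer_to_snd_def)
  ultimately show ?thesis
    by (simp add: closedin_def)
qed

lemma closer_to_snd_in_Cld:
  assumes "P \<in> T4_pairs X"
  shows "closer_to_snd P \<in> Cld X"
proof -
  have "continuous_map X (prod_topology X (T4_space X)) (\<lambda>x. (x, P))"
    using assms by (simp add: continuous_map_pairedI topspace_T4_space)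
  from closedin_continuous_map_preimage[OF this closedin_closer_to_snd_graph]
  have "closedin X {x \<in> topspace X. x \<in> closer_to_snd P}"
    using assms by simp
  moreover have "{x \<in> topspace X. x \<in> closer_to_snd P} = closer_to_snd P"
    by (auto simp: closer_to_snd_def)
  ultimately have closed: "closedin X (closer_to_snd P)"
    by simp
  obtain F1 F2 where P: "P = (F1, F2)" "F1 \<in> Cld X" "F2 \<in> Cld X"
    using assms by (auto simp: T4_pairs_def)
  obtain x where "x \<in> F2"
    using P by (auto simp: Cld_def)
  \<comment> \<open>Points of the second set belong to it because every point is closest to itself.\<close>
  moreover have "s x q \<le> s x x" if "q \<in> F1" for q
  proof (cases "q = x")
    case False
    moreover have "x \<in> topspace X" "q \<in> topspace X"
      using that \<open>x \<in> F2\<close> P Cld_subset_topspace by auto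
    ultimately show ?thesis
      using self by (simp add: less_imp_le)
  qed simp
  ultimately have "x \<in> closer_to_snd P"
    using P Cld_subset_topspace by (auto simp: closer_to_snd_def)
  with closed show ?thesis
    by (auto simp: Cld_def)
qed

text \<open>
  Preimages of \<open>U\<^sup>-\<close> are open because a point of \<open>U\<close> at least as close to \<open>F\<^sub>2\<close> as to \<open>F\<^sub>1\<close> can be moved
  within \<open>U\<close> to one strictly closer to \<open>F\<^sub>2\<close>, a property preserved under small changes of both sets;
  preimages of \<open>U\<^sup>+\<close> are open because projecting along a compact space is a closed map.
\<close>

lemma continuous_map_closer_to_snd: "continuous_map (T4_space X) (vietoris X) closer_to_snd"
proof -
  have minus: "openin (T4_space X) (closer_to_snd -` vietoris_minus X U \<inter> T4_pairs X)"
    if U: "openin X U" for U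
  proof (intro iffD2[OF openin_subopen] ballI)
    fix P assume "P \<in> closer_to_snd -` vietoris_minus X U \<inter> T4_pairs X"
    then obtain F1 F2 x where P: "P = (F1, F2)" "(F1, F2) \<in> T4_pairs X"
      and x: "x \<in> U" "x \<in> closer_to_snd (F1, F2)"
      by (cases P) (auto simp: vietoris_minus_def)
    have F: "F1 \<in> Cld X" "F2 \<in> Cld X" "F1 \<inter> F2 = {}"
      using P by (auto simp: T4_pairs_def)
    have xX: "x \<in> topspace X"
      using x by (auto simp: closer_to_snd_def)
    obtain p where p: "p \<in> F2" "\<And>r. r \<in> F2 \<Longrightarrow> s x r \<le> s x p"
      using Cld_attains_closest[OF F(2) xX] by blast
    have "s x q \<le> s x p" if q: "q \<in> F1" for q
    proof -
      obtain r where "r \<in> F2" "s x q \<le> s x r"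
        using x(2) q by (auto simp: closer_to_snd_def)
      with p(2)[of r] show ?thesis
        by simp
    qed
    moreover have "p \<in> topspace X" "F1 \<subseteq> topspace X" "p \<notin> F1"
      using p(1) F Cld_subset_topspace by auto
    ultimately obtain y where y: "y \<in> U" "\<And>q. q \<in> F1 \<Longrightarrow> s y q < s y p"
      using approach[OF U x(1), of p] by (metis subsetD)
    have yX: "y \<in> topspace X"
      using y U openin_subset by blast
    obtain m where m: "m \<in> F1" "\<And>q. q \<in> F1 \<Longrightarrow> s y q \<le> s y m"
      using Cld_attains_closest[OF F(1) yX] by blast
    obtain c where c: "s y m < c" "c < s y p"
      using y(2)[OF m(1)] dense by blast
    define L where "L = {z \<in> topspace X. s y z \<in> {..<c}}"
    define R where "R = {z \<in> topspace X. s y z \<in> {c<..}}"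
    have LR: "openin X L" "openin X R"
      unfolding L_def R_def
      by (rule openin_continuous_map_preimage[OF continuous_map_closeness[OF yX]]; simp)+
    let ?N = "T4_pairs X \<inter> vietoris_plus X L \<times> vietoris_minus X R"
    have "openin (T4_space X) ?N"
      using LR by (simp add: openin_T4_space_Times openin_vietoris_minus openin_vietoris_plus)
    moreover have "P \<in> ?N"
    proof -
      have "F1 \<subseteq> L"
        using m(2) c F(1) Cld_subset_topspace by (fastforce simp: L_def)
      moreover have "p \<in> R"
        using p(1) c F(2) Cld_subset_topspace by (auto simp: R_def)
      ultimately show ?thesis
        using P F p(1) by (auto simp: vietoris_minus_def vietoris_plus_def)
    qed
    moreover have "?N \<subseteq> closer_to_snd -` vietoris_minus X U \<inter> T4_pairs X"
    proof
      fix Q assume "Q \<in> ?N"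
      then obtain E1 E2 where Q: "Q = (E1, E2)"
        and E: "(E1, E2) \<in> T4_pairs X" "E1 \<in> vietoris_plus X L" "E2 \<in> vietoris_minus X R"
        by (cases Q) auto
      then obtain r where "r \<in> E2" "r \<in> R"
        by (auto simp: vietoris_minus_def)
      moreover have "s y q \<le> s y r" if "q \<in> E1" for q
        using that E(2) \<open>r \<in> R\<close> by (fastforce simp: vietoris_plus_def L_def R_def)
      ultimately have "y \<in> closer_to_snd (E1, E2)"
        using yX by (auto simp: closer_to_snd_def)
      then show "Q \<in> closer_to_snd -` vietoris_minus X U \<inter> T4_pairs X"
        using E(1) y(1) closer_to_snd_in_Cld[OF E(1)] by (auto simp: Q vietoris_minus_def)
    qed
    ultimately show "\<exists>T. openin (T4_space X) T \<and> P \<in> T \<and>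
        T \<subseteq> closer_to_snd -` vietoris_minus X U \<inter> T4_pairs X"
      by (intro exI conjI)
  qed
  have plus: "openin (T4_space X) (closer_to_snd -` vietoris_plus X U \<inter> T4_pairs X)"
    if U: "openin X U" for U
  proof -
    let ?G = "{(x, P). P \<in> T4_pairs X \<and> x \<in> closer_to_snd P}"
    let ?C = "?G \<inter> (topspace X - U) \<times> topspace (T4_space X)"
    have "closedin (prod_topology X (T4_space X)) ?C"
      using U by (intro closedin_Int closedin_closer_to_snd_graph)
        (simp add: closedin_prod_Times_iff closedin_diff)
    then have "closedin (T4_space X) (snd ` ?C)"
      using Abstract_Topological_Spaces.closed_map_snd[OF compact] unfolding closed_map_def by blast
    moreover have "snd ` ?C = {P \<in> T4_pairs X. \<not> closer_to_snd P \<subseteq> U}"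
    proof (intro subset_antisym subsetI)
      fix P assume "P \<in> {P \<in> T4_pairs X. \<not> closer_to_snd P \<subseteq> U}"
      then obtain x where "P \<in> T4_pairs X" "x \<in> closer_to_snd P" "x \<notin> U" "x \<in> topspace X"
        by (auto simp: closer_to_snd_def)
      then have "(x, P) \<in> ?C"
        by (simp add: topspace_T4_space)
      then show "P \<in> snd ` ?C"
        by (rule image_eqI[rotated]) simp
    qed auto
    ultimately have "openin (T4_space X) (topspace (T4_space X) - {P \<in> T4_pairs X. \<not> closer_to_snd P \<subseteq> U})"
      by (simp add: openin_diff)
    moreover have "closer_to_snd -` vietoris_plus X U \<inter> T4_pairs X =
        topspace (T4_space X) - {P \<in> T4_pairs X. \<not> closer_to_snd P \<subseteq> U}"
      by (auto simp: vietoris_plus_def topspace_T4_space dest: closer_to_snd_in_Cld)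
    ultimately show ?thesis
      by simp
  qed
  show ?thesis
    unfolding vietoris_def
  proof (rule continuous_on_generated_topo)
    show "closer_to_snd ` topspace (T4_space X)
        \<subseteq> \<Union> ({vietoris_minus X U |U. openin X U} \<union> {vietoris_plus X U |U. openin X U})"
      using closer_to_snd_in_Cld topspace_vietoris[of X]
      unfolding vietoris_def topology_generated_by_topspace topspace_T4_space by blast
    show "openin (T4_space X) (closer_to_snd -` V \<inter> topspace (T4_space X))"
      if "V \<in> {vietoris_minus X U |U. openin X U} \<union> {vietoris_plus X U |U. openin X U}" for V
      using that minus plus unfolding topspace_T4_space by blast
  qed
qed

theorem CT4_closeness: "CT4 X"
  unfolding CT4_def
proof (intro exI conjI allI impI)
  let ?\<phi> = "\<lambda>P. (closer_to_snd P, closer_to_snd (prod.swap P))"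
  have "continuous_map (T4_space X) (T4_space X) prod.swap"
  proof -
    have "continuous_map (T4_space X) (prod_topology (vietoris X) (vietoris X)) prod.swap"
      unfolding T4_space_def prod.swap_def
      by (intro continuous_map_from_subtopology continuous_map_pairedI continuous_map_fst continuous_map_snd)
    moreover have "prod.swap \<in> topspace (T4_space X) \<rightarrow> T4_pairs X"
      unfolding topspace_T4_space by (auto simp: T4_pairs_def)
    ultimately show ?thesis
      by (subst (2) T4_space_def) (simp add: continuous_map_in_subtopology)
  qed
  then show "continuous_map (T4_space X) (prod_topology (vietoris X) (vietoris X)) ?\<phi>"
    using continuous_map_compose[OF _ continuous_map_closer_to_snd, of "T4_space X" prod.swap]
    by (simp add: continuous_map_pairedI continuous_map_closer_to_snd o_def)
  have disj: "F1 \<inter> closer_to_snd (F1, F2) = {}" if P: "(F1, F2) \<in> T4_pairs X" for F1 F2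
  proof (rule equals0I)
    fix x assume "x \<in> F1 \<inter> closer_to_snd (F1, F2)"
    then obtain p where x: "x \<in> F1" "p \<in> F2" "s x x \<le> s x p"
      by (auto simp: closer_to_snd_def)
    then have "x \<noteq> p" "x \<in> topspace X" "p \<in> topspace X"
      using P Cld_subset_topspace by (auto simp: T4_pairs_def)
    with self[of x p] x show False
      by auto
  qed
  fix F1 F2 assume P: "(F1, F2) \<in> T4_pairs X"
  then have P': "(F2, F1) \<in> T4_pairs X"
    by (auto simp: T4_pairs_def)
  show "F1 \<inter> fst (?\<phi> (F1, F2)) = {}" "F2 \<inter> snd (?\<phi> (F1, F2)) = {}"
    using disj[OF P] disj[OF P'] by auto
  show "fst (?\<phi> (F1, F2)) \<union> snd (?\<phi> (F1, F2)) = topspace X"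
  proof
    show "topspace X \<subseteq> fst (?\<phi> (F1, F2)) \<union> snd (?\<phi> (F1, F2))"
    proof
      fix x assume x: "x \<in> topspace X"
      show "x \<in> fst (?\<phi> (F1, F2)) \<union> snd (?\<phi> (F1, F2))"
      proof (cases "x \<in> closer_to_snd (F1, F2)")
        case False
        then obtain q where "q \<in> F1" "\<And>p. p \<in> F2 \<Longrightarrow> s x p < s x q"
          using x by (force simp: closer_to_snd_def)
        then have "x \<in> closer_to_snd (F2, F1)"
          using x less_imp_le by (auto simp: closer_to_snd_def intro!: bexI[of _ q])
        then show ?thesis
          by simp
      qed simp
    qed
  qed (auto simp: closer_to_snd_def)
qed

end

section \<open>The inner product on the sphere\<close>

lemma compact_space_nsphere: "compact_space (nsphere n)"
proof -
  let ?S = "{x :: nat \<Rightarrow> real. (\<Sum>i\<le>n. x i ^ 2) = 1 \<and> (\<forall>i>n. x i = 0)}"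
  have coord: "continuous_map (powertop_real UNIV) euclideanreal (\<lambda>x. x i)" for i :: nat
    by (rule continuous_map_product_projection) simp
  have "closedin (powertop_real UNIV) ({x \<in> topspace (powertop_real UNIV). (\<Sum>i\<le>n. x i ^ 2) \<in> {1}} \<inter>
      (\<Inter>i\<in>{n<..}. {x \<in> topspace (powertop_real UNIV). x i \<in> {0}}))"
    by (intro closedin_Int closedin_INT
        closedin_continuous_map_preimage[where Y = euclideanreal]
        continuous_map_sum continuous_map_real_pow coord) auto
  moreover have "{x \<in> topspace (powertop_real UNIV). (\<Sum>i\<le>n. x i ^ 2) \<in> {1}} \<inter>
      (\<Inter>i\<in>{n<..}. {x \<in> topspace (powertop_real UNIV). x i \<in> {0}}) = ?S"
    by auto
  ultimately have "closedin (powertop_real UNIV) ?S"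
    by simp
  moreover have "compactin (powertop_real UNIV) (\<Pi>\<^sub>E i\<in>UNIV. {-1..1::real})"
    by (simp add: compactin_PiE)
  moreover have "?S \<subseteq> (\<Pi>\<^sub>E i\<in>UNIV. {-1..1::real})"
  proof (clarsimp simp: PiE_def)
    fix x :: "nat \<Rightarrow> real" and i
    assume x: "(\<Sum>i\<le>n. x i ^ 2) = 1" "\<forall>i>n. x i = 0"
    have "(x i)\<^sup>2 \<le> 1"
    proof (cases "i \<le> n")
      case True
      then show ?thesis
        using member_le_sum[of i "{..n}" "\<lambda>i. (x i)\<^sup>2"] x by simp
    qed (use x in simp)
    then show "- 1 \<le> x i \<and> x i \<le> 1"
      using abs_square_le_1[of "x i"] by (simp add: abs_le_iff)
  qed
  ultimately have "compactin (powertop_real UNIV) ?S"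
    using closed_compactin by blast
  then show ?thesis
    unfolding nsphere by (rule compact_space_subtopology)
qed

text \<open>
  The standard inner product of \<open>\<real>\<^bsup>n+1\<^esup>\<close>, whose vectors are encoded as sequences supported on
  \<open>{0..n}\<close>, as in \<^const>\<open>nsphere\<close>.
\<close>

definition dot :: "nat \<Rightarrow> (nat \<Rightarrow> real) \<Rightarrow> (nat \<Rightarrow> real) \<Rightarrow> real" where
  "dot n x y = (\<Sum>i\<le>n. x i * y i)"

lemma topspace_nsphere: "topspace (nsphere n) = {x. dot n x x = 1 \<and> (\<forall>i>n. x i = 0)}"
  by (simp add: nsphere dot_def power2_eq_square)

lemma dot_less_1:
  assumes "x \<in> topspace (nsphere n)" "y \<in> topspace (nsphere n)" "y \<noteq> x"
  shows "dot n x y < 1"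
proof -
  have "\<exists>i. y i \<noteq> x i"
    using assms(3) by (simp add: fun_eq_iff)
  then obtain i where i: "y i \<noteq> x i" ..
  have "x j = y j" if "j > n" for j
    using assms(1,2) that by (simp add: topspace_nsphere)
  with i have "i \<le> n"
    by (metis not_le)
  then have "0 < (\<Sum>i\<le>n. (x i - y i)\<^sup>2)"
    using i by (intro sum_pos2[of _ i]) simp_all
  also have "\<dots> = (\<Sum>i\<le>n. x i * x i + y i * y i - 2 * (x i * y i))"
    by (simp add: power2_eq_square algebra_simps)
  also have "\<dots> = dot n x x + dot n y y - 2 * dot n x y"
    by (simp only: dot_def sum.distrib sum_subtractf sum_distrib_left)
  finally show ?thesis
    using assms by (simp add: topspace_nsphere)
qed

text \<open>
  Passing from \<open>x\<close> to \<open>x + t p\<close> with \<open>t > 0\<close> increases the inner product with \<open>p\<close> more than that with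
  any other \<open>q\<close> of the sphere, because \<open>p \<bullet> q < 1 = p \<bullet> p\<close>; normalizing does not affect the
  comparison.
\<close>

lemma dot_approach:
  assumes U: "openin (nsphere n) U" and x: "x \<in> U" and p: "p \<in> topspace (nsphere n)"
  shows "\<exists>y\<in>U. \<forall>q\<in>topspace (nsphere n). q \<noteq> p \<longrightarrow> dot n x q \<le> dot n x p \<longrightarrow> dot n y q < dot n y p"
proof -
  have xS: "x \<in> topspace (nsphere n)"
    using openin_subset[OF U] x by (rule subsetD)
  define w where "w = (\<lambda>t i. x i + t * p i)"
  define N where "N = (\<lambda>t. sqrt (dot n (w t) (w t)))"
  have dot_w: "dot n (w t) z = dot n x z + t * dot n p z" for t z
    by (simp add: w_def dot_def sum.distrib sum_distrib_left algebra_simps)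
  \<comment> \<open>The segment towards \<open>p\<close> can meet the origin only at \<open>t = 1\<close>, namely when \<open>p = - x\<close>.\<close>
  have Npos: "0 < dot n (w t) (w t)" if t: "0 \<le> t" "t < 1" for t
  proof (rule ccontr)
    assume "\<not> 0 < dot n (w t) (w t)"
    moreover have "0 \<le> dot n (w t) (w t)"
      by (simp add: dot_def sum_nonneg)
    ultimately have "(\<Sum>i\<le>n. w t i * w t i) = 0"
      by (simp add: dot_def)
    then have "x i = - t * p i" if "i \<le> n" for i
      using that by (subst (asm) sum_nonneg_eq_0_iff) (auto simp: w_def eq_neg_iff_add_eq_0)
    then have "dot n x x = t\<^sup>2 * dot n p p"
      by (simp add: dot_def sum_distrib_left power2_eq_square algebra_simps)
    then have "t\<^sup>2 = 1"
      using xS p by (simp add: topspace_nsphere)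
    with t show False
      by (simp add: power2_eq_1_iff)
  qed
  define \<gamma> where "\<gamma> = (\<lambda>t i. w t i / N t)"
  have dot_\<gamma>: "dot n (\<gamma> t) z = dot n (w t) z / N t" for t z
    by (simp add: \<gamma>_def dot_def sum_divide_distrib)
  have cont: "continuous_map (top_of_set {0..<1}) (nsphere n) \<gamma>"
    unfolding nsphere continuous_map_in_subtopology
  proof
    have "continuous_on {0..<1} (\<lambda>t. \<gamma> t i)" for i
      using Npos unfolding \<gamma>_def N_def w_def dot_def
      by (intro continuous_intros) force
    then show "continuous_map (top_of_set {0..<1}) (powertop_real UNIV) \<gamma>"
      by (simp add: continuous_map_componentwise_UNIV)
    have "dot n (\<gamma> t) (\<gamma> t) = 1" if "0 \<le> t" "t < 1" for t
    proof -
      have "dot n (\<gamma> t) (\<gamma> t) = dot n (w t) (w t) / (N t)\<^sup>2"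
        by (simp add: \<gamma>_def dot_def sum_divide_distrib power2_eq_square)
      then show ?thesis
        using Npos[OF that] by (simp add: N_def)
    qed
    moreover have "\<gamma> t i = 0" if "i > n" for t i
      using that xS p by (simp add: \<gamma>_def w_def topspace_nsphere)
    ultimately show "\<gamma> \<in> topspace (top_of_set {0..<1}) \<rightarrow> {x. (\<Sum>i\<le>n. (x i)\<^sup>2) = 1 \<and> (\<forall>i>n. x i = 0)}"
      by (auto simp: dot_def power2_eq_square)
  qed
  have "\<gamma> 0 = x"
    using xS by (simp add: \<gamma>_def N_def w_def topspace_nsphere)
  obtain t where t: "0 < t" "t < 1" "\<gamma> t \<in> U"
  proof -
    have "openin (top_of_set {0..<1}) {t \<in> {0..<1}. \<gamma> t \<in> U}"
      using openin_continuous_map_preimage[OF cont U] by simp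
    moreover have "0 \<in> {t \<in> {0..<1}. \<gamma> t \<in> U}"
      using x \<open>\<gamma> 0 = x\<close> by simp
    ultimately obtain e where e: "e > 0" "ball 0 e \<inter> {0..<1} \<subseteq> {t \<in> {0..<1}. \<gamma> t \<in> U}"
      unfolding openin_contains_ball by blast
    define t where "t = min (e/2) (1/2)"
    have t: "0 < t" "t < 1" "t < e"
      using e(1) by (auto simp: t_def)
    then have "t \<in> ball 0 e \<inter> {0..<1}"
      by simp
    with e(2) have "\<gamma> t \<in> U"
      by blast
    with t show ?thesis
      by (intro that)
  qed
  show ?thesis
  proof (intro bexI[of _ "\<gamma> t"] ballI impI)
    fix q assume q: "q \<in> topspace (nsphere n)" "q \<noteq> p" "dot n x q \<le> dot n x p"
    have "dot n p q < dot n p p"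
      using dot_less_1[OF p q(1,2)] p by (simp add: topspace_nsphere)
    then have "dot n (w t) q < dot n (w t) p"
      using q(3) t(1) by (simp add: dot_w add_le_less_mono)
    then show "dot n (\<gamma> t) q < dot n (\<gamma> t) p"
      using Npos[of t] t by (simp add: dot_\<gamma> N_def divide_strict_right_mono)
  qed (use t in simp)
qed

lemma closeness_nsphere: "closeness (nsphere n) (dot n)"
proof
  have "continuous_map (prod_topology (nsphere n) (nsphere n)) euclideanreal (\<lambda>z. fst z i)"
    "continuous_map (prod_topology (nsphere n) (nsphere n)) euclideanreal (\<lambda>z. snd z i)" for i
    using continuous_map_compose[OF continuous_map_fst continuous_map_nsphere_projection[of n i]]
      continuous_map_compose[OF continuous_map_snd continuous_map_nsphere_projection[of n i]]
    by (simp_all only: o_def)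
  then show "continuous_map (prod_topology (nsphere n) (nsphere n)) euclideanreal
      (\<lambda>z. dot n (fst z) (snd z))"
    unfolding dot_def by (intro continuous_map_sum continuous_map_real_mult) auto
  show "dot n x y < dot n x x"
    if "x \<in> topspace (nsphere n)" "y \<in> topspace (nsphere n)" "y \<noteq> x" for x y
    using dot_less_1[OF that] that by (simp add: topspace_nsphere)
qed (rule compact_space_nsphere, rule dot_approach)

theorem mainTheorem9:
  fixes n :: nat
  assumes "n \<ge> 1"
  shows "CT4 (nsphere n)"
  using closeness.CT4_closeness[OF closeness_nsphere] .

end
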